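(* Let $G$ be a threshold graph with $2c$ vertices that has a perfect matching. Consider the greedy algorithm: starting with $G_0=G$, at step $i$ select the edge of maximum weight in $G_i$ (breaking ties by the fixed order on the edges) and let $G_{i+1}$ be obtained from $G_i$ by deleting both endpoints of this edge and all edges incident to them; stop after $c$ edges have been selected. Then the greedy algorithm selects $c$ edges forming a dominant perfect matching of $G$.
   Context: A threshold graph here is an undirected graph $G=(V,E)$ in which each vertex $x$ has a weight $w(x)\ge0$ and, for a threshold $t>0$, $E=\{(x,y):x\ne y,\ w(x)+w(y)\le t\}$. The weight of an edge $(x,y)$ is $w(x)+w(y)$. A fixed arbitrary order on $E$ is used to break ties between edges of equal weight, so that for a perfect matching $A$ the $i$-th heaviest edge $A_i$ is uniquely defined. A perfect matching $A$ dominates a perfect matching $B$ if $\sum_{i=1}^xw(A_i)\ge\sum_{i=1}^xw(B_i)$ for every $x\in\{1,\dots,c\}$; $A$ is a dominant perfect matching if it dominates every perfect matching of $G$. *)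

theory Defs
  imports Complex_Main
begin

text \<open>Undirected graphs are pairs of a vertex set and a set of edges; an edge is the set of its
  two endpoints.\<close>

type_synonym 'v graph = "'v set \<times> 'v set set"

abbreviation verts :: "'v graph \<Rightarrow> 'v set" where
  "verts G \<equiv> fst G"

abbreviation edges :: "'v graph \<Rightarrow> 'v set set" where
  "edges G \<equiv> snd G"

definition threshold_graph :: "('v \<Rightarrow> real) \<Rightarrow> real \<Rightarrow> 'v graph \<Rightarrow> bool" where
  "threshold_graph w t G \<longleftrightarrow>
     finite (verts G) \<and> (\<forall>x\<in>verts G. 0 \<le> w x) \<and> 0 < t \<and>
     edges G = {{x, y} | x y. x \<in> verts G \<and> y \<in> verts G \<and> x \<noteq> y \<and> w x + w y \<le> t}"

definition edge_weight :: "('v \<Rightarrow> real) \<Rightarrow> 'v set \<Rightarrow> real" where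
  "edge_weight w e = (\<Sum>x\<in>e. w x)"

definition perfect_matching :: "'v graph \<Rightarrow> 'v set set \<Rightarrow> bool" where
  "perfect_matching G M \<longleftrightarrow> M \<subseteq> edges G \<and> (\<forall>v\<in>verts G. \<exists>!e. e \<in> M \<and> v \<in> e)"

text \<open>The tie-breaking order is a relation \<open>r\<close>, linear on the edges. Among edges of equal
  weight, the one that comes first in \<open>r\<close> counts as heavier.\<close>

definition heavier :: "('v \<Rightarrow> real) \<Rightarrow> 'v set rel \<Rightarrow> 'v set \<Rightarrow> 'v set \<Rightarrow> bool" where
  "heavier w r e f \<longleftrightarrow>
     edge_weight w e > edge_weight w f \<or>
     edge_weight w e = edge_weight w f \<and> e \<noteq> f \<and> (e, f) \<in> r"

text \<open>Indices start at 1: the \<open>i\<close>-th heaviest edge has exactly \<open>i - 1\<close> edges before it.\<close>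

definition ith_heaviest :: "('v \<Rightarrow> real) \<Rightarrow> 'v set rel \<Rightarrow> 'v set set \<Rightarrow> nat \<Rightarrow> 'v set" where
  "ith_heaviest w r A i = (THE e. e \<in> A \<and> Suc (card {f \<in> A. heavier w r f e}) = i)"

definition dominates ::
  "('v \<Rightarrow> real) \<Rightarrow> 'v set rel \<Rightarrow> nat \<Rightarrow> 'v set set \<Rightarrow> 'v set set \<Rightarrow> bool" where
  "dominates w r c A B \<longleftrightarrow>
     (\<forall>x\<in>{1..c}. (\<Sum>i=1..x. edge_weight w (ith_heaviest w r A i))
                  \<ge> (\<Sum>i=1..x. edge_weight w (ith_heaviest w r B i)))"

definition dominant_perfect_matching ::
  "('v \<Rightarrow> real) \<Rightarrow> 'v set rel \<Rightarrow> nat \<Rightarrow> 'v graph \<Rightarrow> 'v set set \<Rightarrow> bool" where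
  "dominant_perfect_matching w r c G A \<longleftrightarrow>
     perfect_matching G A \<and> (\<forall>B. perfect_matching G B \<longrightarrow> dominates w r c A B)"

definition max_weight_edge :: "('v \<Rightarrow> real) \<Rightarrow> 'v set rel \<Rightarrow> 'v graph \<Rightarrow> 'v set" where
  "max_weight_edge w r G = (THE e. e \<in> edges G \<and> (\<forall>f\<in>edges G. f \<noteq> e \<longrightarrow> heavier w r e f))"

definition delete_vertices :: "'v graph \<Rightarrow> 'v set \<Rightarrow> 'v graph" where
  "delete_vertices G S = (verts G - S, {f \<in> edges G. f \<inter> S = {}})"

text \<open>The list of edges selected in at most \<open>n\<close> greedy steps, in order of selection. It has
  fewer than \<open>n\<close> elements exactly if the algorithm gets stuck, i.e. reaches a graph without
  edges too early.\<close>

primrec greedy :: "('v \<Rightarrow> real) \<Rightarrow> 'v set rel \<Rightarrow> nat \<Rightarrow> 'v graph \<Rightarrow> 'v set list" where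
  "greedy w r 0 G = []"
| "greedy w r (Suc n) G =
     (if edges G = {} then []
      else let e = max_weight_edge w r G in e # greedy w r n (delete_vertices G e))"

end

theory Submission
  imports Defs "HOL-Library.Disjoint_Sets"
begin

text \<open>Let \<open>e = {a, b}\<close> be the heaviest edge and let a perfect matching \<open>B\<close> match \<open>a\<close> with \<open>a'\<close>
  and \<open>b\<close> with \<open>b'\<close>. Maximality of \<open>e\<close> gives \<open>w a' \<le> w b\<close>, so \<open>w a' + w b' \<le> w b + w b' \<le> t\<close> and
  \<open>{a', b'}\<close> is an edge. Swapping \<open>{a, a'}, {b, b'}\<close> for \<open>{a, b}, {a', b'}\<close> thus yields a perfect
  matching through \<open>e\<close>, and it keeps the total weight while creating an edge at least as heavy
  as both old ones. Hence every set of \<open>x + 1\<close> edges of \<open>B\<close> weighs at most \<open>e\<close> together with \<open>x\<close>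
  edges of a perfect matching of \<open>G - e\<close>, and by induction at most the first \<open>x + 1\<close> greedy
  edges. This bound needs no sorting of the matchings, because the \<open>x\<close> heaviest edges of a
  matching maximise the weight among its \<open>x\<close>-element subsets.\<close>

section \<open>Ranking the edges of a finite set\<close>

lemma heavier_trans:
  assumes "trans r" "antisym r" "heavier w r e f" "heavier w r f g"
  shows "heavier w r e g"
  using assms unfolding heavier_def
  by (smt (verit) antisymD transD)

lemma heavier_irrefl: "\<not> heavier w r e e"
  by (simp add: heavier_def)

lemma heavier_total:
  assumes "total_on M r" "e \<in> M" "f \<in> M" "e \<noteq> f"
  shows "heavier w r e f \<or> heavier w r f e"
  using assms unfolding heavier_def total_on_def by fastforce

lemma heavier_weight: "heavier w r e f \<Longrightarrow> edge_weight w f \<le> edge_weight w e"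
  by (auto simp: heavier_def)

text \<open>The position that \<open>ith_heaviest\<close> inverts; \<open>Suc\<close> makes ranks
  start at 1.\<close>

definition rank_in :: "('v \<Rightarrow> real) \<Rightarrow> 'v set rel \<Rightarrow> 'v set set \<Rightarrow> 'v set \<Rightarrow> nat" where
  "rank_in w r M e = Suc (card {f \<in> M. heavier w r f e})"

text \<open>By transitivity every edge before \<open>e\<close> is also before \<open>f\<close>; the
  inclusion is strict because \<open>e\<close> precedes \<open>f\<close> but not itself.\<close>

lemma rank_in_less:
  assumes "finite M" "trans r" "antisym r" "e \<in> M" "heavier w r e f"
  shows "rank_in w r M e < rank_in w r M f"
proof -
  have "{g \<in> M. heavier w r g e} \<subset> {g \<in> M. heavier w r g f}"
    using assms heavier_trans[OF assms(2,3)] heavier_irrefl by blast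
  then show ?thesis
    unfolding rank_in_def using assms(1) by (simp add: psubset_card_mono)
qed

lemma heavier_if_rank_in_less:
  assumes "finite M" "trans r" "antisym r" "total_on M r" "e \<in> M" "f \<in> M"
    and "rank_in w r M e < rank_in w r M f"
  shows "heavier w r e f"
  using assms heavier_total[OF assms(4), of e f w] rank_in_less[OF assms(1-3)]
  by (metis less_asym less_irrefl)

text \<open>Distinct edges are comparable, so their ranks differ; no edge precedes itself, so ranks
  stay within \<open>card M\<close>. Counting then yields surjectivity.\<close>

lemma bij_betw_rank_in:
  assumes "finite M" "trans r" "antisym r" "total_on M r"
  shows "bij_betw (rank_in w r M) M {1..card M}"
proof -
  have inj: "inj_on (rank_in w r M) M"
    using heavier_total[OF assms(4)] rank_in_less[OF assms(1-3)]
    by (metis inj_onI less_irrefl)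
  have "card {f \<in> M. heavier w r f e} < card M" if "e \<in> M" for e
    using that assms(1) heavier_irrefl by (intro psubset_card_mono) auto
  then have "rank_in w r M ` M \<subseteq> {1..card M}"
    by (auto simp: rank_in_def Suc_le_eq)
  moreover have "card (rank_in w r M ` M) = card {1..card M}"
    using card_image[OF inj] by simp
  ultimately show ?thesis
    using inj by (simp add: bij_betw_def card_subset_eq)
qed

lemma ith_heaviest_rank_in:
  assumes "finite M" "trans r" "antisym r" "total_on M r" "e \<in> M"
  shows "ith_heaviest w r M (rank_in w r M e) = e"
  unfolding ith_heaviest_def
proof (rule the_equality)
  fix f assume "f \<in> M \<and> Suc (card {g \<in> M. heavier w r g f}) = rank_in w r M e"
  then show "f = e"
    using bij_betw_rank_in[OF assms(1-4), of w] assms(5)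
    unfolding bij_betw_def rank_in_def inj_on_def by auto
qed (use assms in \<open>simp add: rank_in_def\<close>)

text \<open>Turns the indexed sums of \<open>dominates\<close> into sums over plain sets of edges,
  which can be compared by exchange.\<close>

lemma sum_ith_heaviest:
  fixes w :: "'v \<Rightarrow> real"
  assumes "finite M" "trans r" "antisym r" "total_on M r" "x \<le> card M"
  defines "T \<equiv> {e \<in> M. rank_in w r M e \<le> x}"
  shows "card T = x"
    and "(\<Sum>i=1..x. edge_weight w (ith_heaviest w r M i)) = sum (edge_weight w) T"
proof -
  have bij: "bij_betw (rank_in w r M) T {1..x}"
  proof (rule bij_betw_subset[OF bij_betw_rank_in[OF assms(1-4)]])
    have "rank_in w r M ` M = {1..card M}"
      using bij_betw_rank_in[OF assms(1-4)] by (rule bij_betw_imp_surj_on)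
    then have "\<exists>e\<in>M. rank_in w r M e = i" if "i \<in> {1..x}" for i
      using that assms(5) by (smt (verit) atLeastAtMost_iff imageE order_trans)
    then show "rank_in w r M ` T = {1..x}"
      unfolding T_def by (fastforce simp: rank_in_def)
  qed (simp add: T_def)
  then show "card T = x"
    by (simp add: bij_betw_same_card)
  show "(\<Sum>i=1..x. edge_weight w (ith_heaviest w r M i)) = sum (edge_weight w) T"
    using sum.reindex_bij_betw[OF bij, of "\<lambda>i. edge_weight w (ith_heaviest w r M i)"]
    by (simp add: T_def ith_heaviest_rank_in[OF assms(1-4)])
qed

text \<open>Let \<open>T\<close> be the \<open>card S\<close> heaviest edges. \<open>S - T\<close>
  and \<open>T - S\<close> are equinumerous, and edges of \<open>T - S\<close> have smaller rank
  than those of \<open>S - T\<close>, so any bijection between them only increases weights.\<close>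

lemma sum_le_sum_ith_heaviest:
  assumes "finite M" "trans r" "antisym r" "total_on M r" "S \<subseteq> M"
  shows "sum (edge_weight w) S \<le> (\<Sum>i=1..card S. edge_weight w (ith_heaviest w r M i))"
proof -
  define T where "T = {e \<in> M. rank_in w r M e \<le> card S}"
  have S: "finite S" "card S \<le> card M"
    using assms(1,5) by (auto intro: finite_subset card_mono)
  note T = sum_ith_heaviest[OF assms(1-4) S(2), of w, folded T_def]
  have finT: "finite T"
    using assms(1) by (simp add: T_def)
  have "card (T - S) = card (S - T)"
    using T(1) S finT by (simp add: card_Diff_subset_Int Int_commute)
  then obtain h where h: "bij_betw h (S - T) (T - S)"
    using S(1) finT by (metis finite_Diff finite_same_card_bij)
  have "sum (edge_weight w) (S - T) \<le> (\<Sum>e\<in>S - T. edge_weight w (h e))"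
  proof (rule sum_mono)
    fix e assume e: "e \<in> S - T"
    then have "h e \<in> T"
      using h by (auto simp: bij_betw_def)
    with e have "heavier w r (h e) e"
      using assms by (intro heavier_if_rank_in_less[of M]) (auto simp: T_def)
    then show "edge_weight w e \<le> edge_weight w (h e)"
      by (rule heavier_weight)
  qed
  also have "\<dots> = sum (edge_weight w) (T - S)"
    using h by (rule sum.reindex_bij_betw)
  finally have "sum (edge_weight w) S \<le> sum (edge_weight w) T"
    using sum.Int_Diff[OF S(1), of "edge_weight w" T] sum.Int_Diff[OF finT, of "edge_weight w" S]
    by (simp add: Int_commute)
  then show ?thesis
    using T(2) by simp
qed

lemma max_weight_edge:
  assumes "finite (edges G)" "trans r" "antisym r" "total_on (edges G) r" "edges G \<noteq> {}"
  shows "max_weight_edge w r G \<in> edges G"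
    and "f \<in> edges G \<Longrightarrow> edge_weight w f \<le> edge_weight w (max_weight_edge w r G)"
proof -
  \<comment> \<open>The edge of rank 1 has none before it, so by totality it precedes all
    others.\<close>
  have "1 \<in> rank_in w r (edges G) ` edges G"
    using bij_betw_imp_surj_on[OF bij_betw_rank_in[OF assms(1-4)]] assms(1,5)
    by (simp add: Suc_le_eq card_gt_0_iff)
  then obtain e where e: "e \<in> edges G" "{f \<in> edges G. heavier w r f e} = {}"
    using assms(1) by (auto simp: rank_in_def)
  then have max: "f \<in> edges G \<Longrightarrow> f \<noteq> e \<Longrightarrow> heavier w r e f" for f
    using heavier_total[OF assms(4)] by blast
  have eq: "max_weight_edge w r G = e"
    unfolding max_weight_edge_def using e max by (intro the_equality) blast+
  show "max_weight_edge w r G \<in> edges G"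
    using e eq by simp
  show "f \<in> edges G \<Longrightarrow> edge_weight w f \<le> edge_weight w (max_weight_edge w r G)"
    using max heavier_weight eq by blast
qed

section \<open>Perfect matchings of threshold graphs\<close>

lemma threshold_graph_edgeE:
  assumes "threshold_graph w t G" "e \<in> edges G" "a \<in> e"
  obtains b where "e = {a, b}" "a \<noteq> b" "a \<in> verts G" "b \<in> verts G" "w a + w b \<le> t"
  using assms unfolding threshold_graph_def
  by (smt (verit) add.commute insertE insert_commute mem_Collect_eq singletonD)

lemma threshold_graph_edgeI:
  assumes "threshold_graph w t G" "a \<in> verts G" "b \<in> verts G" "a \<noteq> b" "w a + w b \<le> t"
  shows "{a, b} \<in> edges G"
  using assms unfolding threshold_graph_def by auto

lemma threshold_graph_edge:
  assumes "threshold_graph w t G" "e \<in> edges G"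
  shows "e \<subseteq> verts G" "card e = 2"
  using assms unfolding threshold_graph_def by auto

lemma threshold_graph_finite:
  assumes "threshold_graph w t G"
  shows "finite (verts G)" "finite (edges G)"
proof -
  show V: "finite (verts G)"
    using assms by (simp add: threshold_graph_def)
  show "finite (edges G)"
    using threshold_graph_edge(1)[OF assms] V by (meson PowI finite_Pow_iff finite_subset subsetI)
qed

text \<open>Weights and threshold stay the same, so the greedy recursion never leaves the class of
  threshold graphs.\<close>

lemma threshold_graph_delete_vertices:
  assumes "threshold_graph w t G"
  shows "threshold_graph w t (delete_vertices G S)"
proof -
  have "{f. (\<exists>x y. f = {x, y} \<and> x \<in> verts G \<and> y \<in> verts G \<and> x \<noteq> y \<and> w x + w y \<le> t) \<and> f \<inter> S = {}} =
        {{x, y} | x y. x \<in> verts G - S \<and> y \<in> verts G - S \<and> x \<noteq> y \<and> w x + w y \<le> t}"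
    by blast
  then show ?thesis
    using assms unfolding threshold_graph_def delete_vertices_def by simp
qed

text \<open>Reduces removing, inserting and swapping edges to computations with unions and
  disjointness. A vertex shared by two edges of \<open>M\<close> lies in \<open>verts G\<close>,
  where uniqueness applies.\<close>

lemma perfect_matching_iff:
  assumes "threshold_graph w t G"
  shows "perfect_matching G M \<longleftrightarrow> M \<subseteq> edges G \<and> \<Union>M = verts G \<and> disjoint M"
proof
  assume M: "perfect_matching G M"
  then have sub: "M \<subseteq> edges G" and ex1: "\<And>v. v \<in> verts G \<Longrightarrow> \<exists>!e. e \<in> M \<and> v \<in> e"
    by (auto simp: perfect_matching_def)
  have edge: "e \<subseteq> verts G" if "e \<in> M" for e
    using that sub threshold_graph_edge(1)[OF assms] by blast
  have "disjoint M"
    unfolding disjoint_def using ex1 edge by blast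
  moreover have "\<Union>M = verts G"
    using ex1 edge by blast
  ultimately show "M \<subseteq> edges G \<and> \<Union>M = verts G \<and> disjoint M"
    using sub by blast
next
  assume "M \<subseteq> edges G \<and> \<Union>M = verts G \<and> disjoint M"
  then show "perfect_matching G M"
    unfolding perfect_matching_def disjoint_def by blast
qed

lemma card_verts_perfect_matching:
  assumes "threshold_graph w t G" "perfect_matching G M"
  shows "card (verts G) = 2 * card M"
proof -
  have M: "M \<subseteq> edges G" "\<Union>M = verts G" "disjoint M"
    using assms perfect_matching_iff by blast+
  have "2 * card M = card (\<Union>M)"
  proof (rule card_partition)
    show "finite M" "finite (\<Union>M)"
      using M threshold_graph_finite[OF assms(1)] finite_subset by auto
    show "card e = 2" if "e \<in> M" for e
      using that M(1) threshold_graph_edge(2)[OF assms(1)] by blast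
  qed (use M(3) in \<open>auto simp: disjoint_def\<close>)
  then show ?thesis
    using M(2) by simp
qed

lemma perfect_matching_insert:
  assumes "threshold_graph w t G" "e \<in> edges G" "perfect_matching (delete_vertices G e) L"
  shows "perfect_matching G (insert e L)"
proof -
  have "L \<subseteq> edges (delete_vertices G e)" "\<Union>L = verts G - e" "disjoint L"
    using assms(3) perfect_matching_iff[OF threshold_graph_delete_vertices[OF assms(1)]]
    by (auto simp: delete_vertices_def)
  then show ?thesis
    unfolding perfect_matching_iff[OF assms(1)]
    using threshold_graph_edge(1)[OF assms(1,2)] assms(2)
    by (auto simp: delete_vertices_def disjoint_def)
qed

lemma perfect_matching_remove:
  assumes "threshold_graph w t G" "perfect_matching G B" "e \<in> B"
  shows "perfect_matching (delete_vertices G e) (B - {e})"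
proof -
  have B: "B \<subseteq> edges G" "\<Union>B = verts G" "disjoint B"
    using assms(1,2) perfect_matching_iff by blast+
  have disj: "f \<inter> e = {}" if "f \<in> B - {e}" for f
    using that assms(3) B(3) by (simp add: disjoint_def)
  have "\<Union>B = e \<union> \<Union>(B - {e})"
    using assms(3) by blast
  moreover have "\<Union>(B - {e}) \<inter> e = {}"
  proof (rule equals0I)
    fix v assume "v \<in> \<Union>(B - {e}) \<inter> e"
    then obtain f where "f \<in> B - {e}" "v \<in> f" "v \<in> e"
      by blast
    then show False
      using disj[of f] by (metis disjoint_iff)
  qed
  ultimately have "\<Union>(B - {e}) = verts G - e"
    unfolding B(2)[symmetric] by (simp add: Un_Diff Diff_triv)
  moreover have "disjoint (B - {e})"
    using B(3) by (simp add: disjoint_def)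
  ultimately show ?thesis
    unfolding perfect_matching_iff[OF threshold_graph_delete_vertices[OF assms(1)]]
    using disj B(1) by (auto simp: delete_vertices_def)
qed

section \<open>The exchange argument\<close>

text \<open>Used with \<open>y\<close> the weight of the heaviest edge, whenever giving up a single
  element of \<open>S\<close> suffices.\<close>

lemma sum_le_if_remove:
  fixes f :: "'a \<Rightarrow> real"
  assumes "finite S" "s \<in> S" "f s \<le> y"
  shows "card S = Suc (card (S - {s})) \<and> sum f S \<le> y + sum f (S - {s})"
  using assms by (metis add_mono_thms_linordered_semiring(3) card_Suc_Diff1 sum.remove)

lemma exchange:
  assumes G: "threshold_graph w t G" and B: "perfect_matching G B"
    and e: "e \<in> edges G" and max: "\<And>f. f \<in> edges G \<Longrightarrow> edge_weight w f \<le> edge_weight w e"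
    and S: "S \<subseteq> B" "S \<noteq> {}"
  shows "\<exists>B' S'. perfect_matching (delete_vertices G e) B' \<and> S' \<subseteq> B' \<and> card S = Suc (card S') \<and>
           sum (edge_weight w) S \<le> edge_weight w e + sum (edge_weight w) S'"
proof -
  have Bd: "B \<subseteq> edges G" "\<Union>B = verts G" "disjoint B"
    using B perfect_matching_iff[OF G] by blast+
  have finS: "finite S"
    using S(1) Bd(1) threshold_graph_finite(2)[OF G] by (meson finite_subset)
  have rem: "card S = Suc (card (S - {s})) \<and>
      sum (edge_weight w) S \<le> edge_weight w e + sum (edge_weight w) (S - {s})" if "s \<in> S" for s
    using sum_le_if_remove[OF finS that] max that S(1) Bd(1) by blast
  show ?thesis
  proof (cases "e \<in> B")
    case True
    \<comment> \<open>\<open>s\<close> is \<open>e\<close> if \<open>e\<close> lies in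
      \<open>S\<close>, and any element of \<open>S\<close> otherwise; either way the rest of
      \<open>S\<close> avoids \<open>e\<close>.\<close>
    obtain s where "s \<in> S" "e \<in> S \<Longrightarrow> s = e"
      using S(2) by blast
    then have "S - {s} \<subseteq> B - {e}"
      using S(1) by blast
    then show ?thesis
      using perfect_matching_remove[OF G B True] rem[OF \<open>s \<in> S\<close>] by blast
  next
    case False
    have "e \<noteq> {}"
      using threshold_graph_edge(2)[OF G e] by auto
    then obtain a where "a \<in> e"
      by blast
    then obtain b where ab: "e = {a, b}" "a \<noteq> b" "a \<in> verts G" "b \<in> verts G"
      using threshold_graph_edgeE[OF G e] by metis
    obtain p q where pq: "p \<in> B" "a \<in> p" "q \<in> B" "b \<in> q"
      using Bd(2) ab(3,4) by blast
    obtain a' where a': "p = {a, a'}" "a \<noteq> a'" "a' \<in> verts G"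
      using threshold_graph_edgeE[OF G _ pq(2)] pq(1) Bd(1) by (metis subsetD)
    obtain b' where b': "q = {b, b'}" "b \<noteq> b'" "b' \<in> verts G" "w b + w b' \<le> t"
      using threshold_graph_edgeE[OF G _ pq(4)] pq(3) Bd(1) by (metis subsetD)
    \<comment> \<open>A common edge would contain both \<open>a\<close> and \<open>b\<close>, hence
      be \<open>e\<close>, which is not in \<open>B\<close>.\<close>
    have "p \<noteq> q"
      using False pq(1) a'(1) b'(1) ab(1,2) by (auto simp: doubleton_eq_iff)
    then have disj: "p \<inter> q = {}"
      using Bd(3) pq(1,3) by (simp add: disjoint_def)
    have "w a + w a' \<le> w a + w b"
      using max[of p] pq(1) Bd(1) a'(1,2) ab(1,2) by (auto simp: edge_weight_def)
    then have wt: "w a' + w b' \<le> t"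
      using b'(4) by simp
    define n where "n = {a', b'}"
    define B' where "B' = insert n (B - {p, q})"
    have nB: "n \<inter> f = {}" "e \<inter> f = {}" if "f \<in> B - {p, q}" for f
    proof -
      have "p \<inter> f = {}" "q \<inter> f = {}"
        using that Bd(3) pq(1,3) by (auto simp: disjoint_def)
      then show "n \<inter> f = {}" "e \<inter> f = {}"
        unfolding n_def ab(1) a'(1) b'(1) by auto
    qed
    have weights: "edge_weight w p + edge_weight w q = edge_weight w e + edge_weight w n"
      using ab(1,2) a'(1,2) b'(1,2) disj by (auto simp: edge_weight_def n_def)
    have n: "n \<in> edges G"
      unfolding n_def using a' b' disj wt by (intro threshold_graph_edgeI[OF G]) auto
    have en: "e \<inter> n = {}"
      using ab(1) a'(1,2) b'(1,2) disj by (auto simp: n_def)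
    \<comment> \<open>Otherwise the nonempty \<open>n\<close> would be disjoint from itself. Hence
      adding \<open>n\<close> to a part of \<open>B - {p, q}\<close> raises the cardinality by
      one.\<close>
    have "n \<notin> B - {p, q}"
      using nB(1)[of n] by (auto simp: n_def)
    have "perfect_matching (delete_vertices G e) B'"
      unfolding perfect_matching_iff[OF threshold_graph_delete_vertices[OF G]]
    proof (intro conjI)
      show "B' \<subseteq> edges (delete_vertices G e)"
        using n en nB(2) Bd(1) by (auto simp: B'_def delete_vertices_def)
      show "disjoint B'"
        using nB(1) Bd(3) by (auto simp: B'_def disjoint_def)
      have "\<Union>B' \<union> e = \<Union>B"
        using pq(1,3) unfolding B'_def n_def ab(1) a'(1) b'(1) by auto
      moreover have "\<Union>B' \<inter> e = {}"
        using en nB(2) unfolding B'_def by blast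
      ultimately show "\<Union>B' = verts (delete_vertices G e)"
        using Bd(2) by (auto simp: delete_vertices_def)
    qed
    moreover have "\<exists>S' \<subseteq> B'. card S = Suc (card S') \<and>
           sum (edge_weight w) S \<le> edge_weight w e + sum (edge_weight w) S'"
    \<comment> \<open>With both old edges in \<open>S\<close>, they are replaced by
      \<open>n\<close>, and \<open>e\<close> makes up the missing weight exactly.\<close>
    proof (cases "p \<in> S \<and> q \<in> S")
      case True
      define R where "R = S - {p, q}"
      have R: "finite R" "n \<notin> R" "S = insert p (insert q R)" "p \<notin> R" "q \<notin> R"
        using True finS \<open>n \<notin> B - {p, q}\<close> S(1) by (auto simp: R_def)
      then have "card S = Suc (card (insert n R))"
        "sum (edge_weight w) S = edge_weight w e + sum (edge_weight w) (insert n R)"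
        using \<open>p \<noteq> q\<close> weights by auto
      moreover have "insert n R \<subseteq> B'"
        using S(1) by (auto simp: B'_def R_def)
      ultimately show ?thesis
        by (metis order_refl)
    next
      case False
      \<comment> \<open>At most one of \<open>p\<close>, \<open>q\<close> is in \<open>S\<close>;
        dropping it, or any element if neither is, leaves edges that survive in
        \<open>B'\<close>.\<close>
      then obtain s where s: "s \<in> S" "p \<in> S \<Longrightarrow> s = p" "q \<in> S \<Longrightarrow> s = q"
        using S(2) by blast
      then have "S - {s} \<subseteq> B'"
        using S(1) unfolding B'_def by blast
      then show ?thesis
        using rem[OF s(1)] by blast
    qed
    ultimately show ?thesis
      by blast
  qed
qed

section \<open>The greedy algorithm\<close>

text \<open>The bound covers arbitrary subsets of arbitrary matchings against a prefix in selection
  order. In this form \<open>exchange\<close> passes it from \<open>G\<close> to the smaller graph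
  without tracking ranks.\<close>

lemma greedy_optimal:
  assumes "threshold_graph w t G" "card (verts G) = 2 * n"
    and "trans r" "antisym r" "total_on (edges G) r" "perfect_matching G M"
  shows "length (greedy w r n G) = n \<and> distinct (greedy w r n G) \<and>
    perfect_matching G (set (greedy w r n G)) \<and>
    (\<forall>B S. perfect_matching G B \<longrightarrow> S \<subseteq> B \<longrightarrow>
       sum (edge_weight w) S \<le> sum_list (map (edge_weight w) (take (card S) (greedy w r n G))))"
  using assms
proof (induction n arbitrary: G M)
  case 0
  have "verts G = {}"
    using 0 threshold_graph_finite(1) by fastforce
  moreover have "B = {}" if "perfect_matching G B" for B
  proof -
    \<comment> \<open>Rules out an infinite \<open>B\<close>, whose \<open>card\<close> would also
      be 0.\<close>
    have "finite B"
      using that 0(1) threshold_graph_finite(2) finite_subset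
      unfolding perfect_matching_def by blast
    then show ?thesis
      using card_verts_perfect_matching[OF 0(1) that] 0(2) by simp
  qed
  then have "S = {}" if "perfect_matching G B" "S \<subseteq> B" for B S
    using that by blast
  ultimately show ?case
    by (force simp: perfect_matching_def)
next
  case (Suc n)
  note G = Suc.prems(1)
  have "card M = Suc n"
    using card_verts_perfect_matching[OF G Suc.prems(6)] Suc.prems(2) by simp
  then have "M \<noteq> {}"
    by auto
  then have ne: "edges G \<noteq> {}"
    using Suc.prems(6) by (auto simp: perfect_matching_def)
  define e where "e = max_weight_edge w r G"
  define G' where "G' = delete_vertices G e"
  define L where "L = greedy w r n G'"
  have e: "e \<in> edges G" and max: "\<And>f. f \<in> edges G \<Longrightarrow> edge_weight w f \<le> edge_weight w e"
    using max_weight_edge[OF threshold_graph_finite(2)[OF G] Suc.prems(3-5) ne]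
    unfolding e_def by blast+
  have greedy: "greedy w r (Suc n) G = e # L"
    using ne by (simp add: L_def G'_def e_def Let_def)
  have G': "threshold_graph w t G'"
    unfolding G'_def by (rule threshold_graph_delete_vertices[OF G])
  have sub: "edges G' \<subseteq> edges G"
    by (auto simp: G'_def delete_vertices_def)
  have card: "card (verts G') = 2 * n"
    using threshold_graph_edge[OF G e] threshold_graph_finite(1)[OF G] Suc.prems(2)
    by (simp add: G'_def delete_vertices_def card_Diff_subset finite_subset)
  \<comment> \<open>Here \<open>exchange\<close> is applied with \<open>S = M\<close> just to obtain
    a perfect matching of the remaining graph, so the algorithm does not get stuck.\<close>
  obtain M' where "perfect_matching G' M'"
    using exchange[OF G Suc.prems(6) e max order_refl \<open>M \<noteq> {}\<close>] unfolding G'_def by blast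
  then have IH: "length L = n" "distinct L" "perfect_matching G' (set L)"
    "\<And>B S. perfect_matching G' B \<Longrightarrow> S \<subseteq> B \<Longrightarrow>
       sum (edge_weight w) S \<le> sum_list (map (edge_weight w) (take (card S) L))"
    using Suc.IH[OF G' card Suc.prems(3,4) total_on_subset[OF Suc.prems(5) sub]]
    unfolding L_def by blast+
  \<comment> \<open>All edges of \<open>G'\<close> are disjoint from \<open>e\<close>; as
    \<open>e\<close> is nonempty, it cannot be one of them.\<close>
  have "e \<noteq> {}"
    using threshold_graph_edge(2)[OF G e] by auto
  then have "e \<notin> set L"
    using IH(3) by (auto simp: perfect_matching_def G'_def delete_vertices_def)
  moreover have "perfect_matching G (set (e # L))"
    using perfect_matching_insert[OF G e] IH(3) by (simp add: G'_def)
  moreover have "sum (edge_weight w) S \<le> sum_list (map (edge_weight w) (take (card S) (e # L)))"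
    if B: "perfect_matching G B" "S \<subseteq> B" for B S
  proof (cases "S = {}")
    case False
    obtain B' S' where "perfect_matching G' B'" "S' \<subseteq> B'" "card S = Suc (card S')"
      "sum (edge_weight w) S \<le> edge_weight w e + sum (edge_weight w) S'"
      using exchange[OF G B(1) e max B(2) False] unfolding G'_def by blast
    \<comment> \<open>Since \<open>card S\<close> is a successor, the prefix consists of
      \<open>e\<close> and the first \<open>card S'\<close> edges of \<open>L\<close>.\<close>
    then show ?thesis
      using IH(4)[of B' S'] by simp
  qed simp
  ultimately show ?case
    unfolding greedy using IH(1,2) by simp
qed

theorem theorem9:
  fixes G :: "'v graph" and w :: "'v \<Rightarrow> real" and t :: real
    and r :: "'v set rel" and c :: nat
  assumes "threshold_graph w t G"
    and "card (verts G) = 2 * c"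
    and "linear_order_on (edges G) r"
    and "\<exists>M. perfect_matching G M"
  shows "length (greedy w r c G) = c \<and> distinct (greedy w r c G) \<and>
         dominant_perfect_matching w r c G (set (greedy w r c G))"
proof -
  define L where "L = greedy w r c G"
  have r: "trans r" "antisym r" "total_on (edges G) r"
    using assms(3) by (auto simp: order_on_defs)
  have L: "length L = c" "distinct L" "perfect_matching G (set L)"
    and opt: "\<And>B S. perfect_matching G B \<Longrightarrow> S \<subseteq> B \<Longrightarrow>
       sum (edge_weight w) S \<le> sum_list (map (edge_weight w) (take (card S) L))"
    using greedy_optimal[OF assms(1,2) r] assms(4) unfolding L_def by blast+
  have matching: "finite B" "total_on B r" "card B = c" if "perfect_matching G B" for B
    using that card_verts_perfect_matching[OF assms(1) that] assms(2) r(3)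
      threshold_graph_finite(2)[OF assms(1)]
    by (auto simp: perfect_matching_def intro: finite_subset total_on_subset)
  have "dominates w r c (set L) B" if B: "perfect_matching G B" for B
    unfolding dominates_def
  proof
    fix x assume "x \<in> {1..c}"
    then have x: "x \<le> card B" "x \<le> length L"
      using matching(3)[OF B] L(1) by simp_all
    \<comment> \<open>The \<open>x\<close> heaviest edges of \<open>B\<close> serve as the subset in
      the greedy bound.\<close>
    define T where "T = {e \<in> B. rank_in w r B e \<le> x}"
    note T = sum_ith_heaviest[OF matching(1)[OF B] r(1,2) matching(2)[OF B] x(1), of w,
        folded T_def]
    have "(\<Sum>i=1..x. edge_weight w (ith_heaviest w r B i)) = sum (edge_weight w) T"
      by (rule T(2))
    also have "\<dots> \<le> sum_list (map (edge_weight w) (take x L))"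
      using opt[OF B, of T] T(1) by (auto simp: T_def)
    also have "\<dots> = sum (edge_weight w) (set (take x L))"
      using L(2) by (simp add: sum_list_distinct_conv_sum_set)
    \<comment> \<open>The first \<open>x\<close> selected edges are some \<open>x\<close>-element
      subset of the greedy matching, so its \<open>x\<close> heaviest edges weigh at least as
      much.\<close>
    also have "\<dots> \<le> (\<Sum>i=1..x. edge_weight w (ith_heaviest w r (set L) i))"
      using sum_le_sum_ith_heaviest[OF matching(1)[OF L(3)] r(1,2) matching(2)[OF L(3)]
          set_take_subset, of w x] x(2) L(2)
      by (simp add: distinct_card)
    finally show "(\<Sum>i=1..x. edge_weight w (ith_heaviest w r (set L) i))
        \<ge> (\<Sum>i=1..x. edge_weight w (ith_heaviest w r B i))" .
  qed
  then show ?thesis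
    using L unfolding dominant_perfect_matching_def L_def by blast
qed

end
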